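(* Let $a,b\in\mathbb{C}\setminus\{0\}$ with $a,b\neq\pm1$ and $a\neq b^{\pm1}$, and let $\mathcal{L}_1$ be the three-dimensional BiHom-Lie algebra over $\mathbb{C}$ with basis $\{e_1,e_2,e_3\}$, structure maps $\alpha_1=\mathrm{diag}(1,a,1/a)$, $\beta_1=\mathrm{diag}(1,b,1/b)$, and brackets $[e_1,e_2]=2b\,e_2$, $[e_1,e_3]=-\frac{2}{b}e_3$, $[e_2,e_1]=-2a\,e_2$, $[e_2,e_3]=\frac{a}{b}e_1$, $[e_3,e_1]=\frac{2}{a}e_3$, $[e_3,e_2]=-\frac{b}{a}e_1$, $[e_i,e_i]=0$. Then the moduli space of Nijenhuis operators on $\mathcal{L}_1$ is $\mathbb{C}^2\cup_{\mathbb{C}}\mathbb{C}^2$, the union of two affine planes intersecting in a line.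
   Context: A BiHom-Lie algebra is a 4-tuple $(L,[\cdot,\cdot],\alpha,\beta)$ with $L$ a vector space over $\mathbb{C}$, $[\cdot,\cdot]:L\times L\to L$ bilinear, $\alpha,\beta:L\to L$ linear, such that for all $x,y,z\in L$: (i) $\alpha\circ\beta=\beta\circ\alpha$; (ii) $\alpha([x,y])=[\alpha(x),\alpha(y)]$ and $\beta([x,y])=[\beta(x),\beta(y)]$; (iii) $[\beta(x),\alpha(y)]=-[\beta(y),\alpha(x)]$; (iv) $[\beta^2(x),[\beta(y),\alpha(z)]]+[\beta^2(y),[\beta(z),\alpha(x)]]+[\beta^2(z),[\beta(x),\alpha(y)]]=0$. A linear map $N:L\to L$ is a Nijenhuis operator on it if $N\circ\alpha=\alpha\circ N$, $N\circ\beta=\beta\circ N$, and $[N(x),N(y)]=N([N(x),y]+[x,N(y)]-N[x,y])$ for all $x,y\in L$. An automorphism is a bijective linear map preserving the bracket and commuting with $\alpha$ and $\beta$. The moduli space of Nijenhuis operators is the set of all Nijenhuis operators modulo conjugation $N\mapsto\phi N\phi^{-1}$ by automorphisms $\phi$. *)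

theory Defs
  imports "HOL-Analysis.Analysis"
begin

locale bihom_lie_algebra = vector_space scl
  for scl :: "complex \<Rightarrow> 'v::ab_group_add \<Rightarrow> 'v" +
  fixes br :: "'v \<Rightarrow> 'v \<Rightarrow> 'v" and \<alpha> \<beta> :: "'v \<Rightarrow> 'v"
  assumes linear_br_right: "\<And>x. Vector_Spaces.linear scl scl (\<lambda>y. br x y)"
    and linear_br_left: "\<And>y. Vector_Spaces.linear scl scl (\<lambda>x. br x y)"
    and linear_alpha: "Vector_Spaces.linear scl scl \<alpha>"
    and linear_beta: "Vector_Spaces.linear scl scl \<beta>"
    and alpha_beta: "\<alpha> \<circ> \<beta> = \<beta> \<circ> \<alpha>"
    and alpha_br: "\<And>x y. \<alpha> (br x y) = br (\<alpha> x) (\<alpha> y)"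
    and beta_br: "\<And>x y. \<beta> (br x y) = br (\<beta> x) (\<beta> y)"
    and bihom_skew: "\<And>x y. br (\<beta> x) (\<alpha> y) = - br (\<beta> y) (\<alpha> x)"
    and bihom_jacobi: "\<And>x y z.
        br (\<beta> (\<beta> x)) (br (\<beta> y) (\<alpha> z))
      + br (\<beta> (\<beta> y)) (br (\<beta> z) (\<alpha> x))
      + br (\<beta> (\<beta> z)) (br (\<beta> x) (\<alpha> y)) = 0"

definition nijenhuis_operators ::
  "(complex \<Rightarrow> 'v::ab_group_add \<Rightarrow> 'v) \<Rightarrow> ('v \<Rightarrow> 'v \<Rightarrow> 'v) \<Rightarrow> ('v \<Rightarrow> 'v) \<Rightarrow> ('v \<Rightarrow> 'v)
    \<Rightarrow> ('v \<Rightarrow> 'v) set" where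
  "nijenhuis_operators scl br \<alpha> \<beta> =
    {N. Vector_Spaces.linear scl scl N \<and> N \<circ> \<alpha> = \<alpha> \<circ> N \<and> N \<circ> \<beta> = \<beta> \<circ> N \<and>
        (\<forall>x y. br (N x) (N y) = N (br (N x) y + br x (N y) - N (br x y)))}"

definition bihom_automorphisms ::
  "(complex \<Rightarrow> 'v::ab_group_add \<Rightarrow> 'v) \<Rightarrow> ('v \<Rightarrow> 'v \<Rightarrow> 'v) \<Rightarrow> ('v \<Rightarrow> 'v) \<Rightarrow> ('v \<Rightarrow> 'v)
    \<Rightarrow> ('v \<Rightarrow> 'v) set" where
  "bihom_automorphisms scl br \<alpha> \<beta> =
    {\<phi>. Vector_Spaces.linear scl scl \<phi> \<and> bij \<phi> \<and>
        (\<forall>x y. \<phi> (br x y) = br (\<phi> x) (\<phi> y)) \<and> \<phi> \<circ> \<alpha> = \<alpha> \<circ> \<phi> \<and> \<phi> \<circ> \<beta> = \<beta> \<circ> \<phi>}"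

definition nijenhuis_conj ::
  "(complex \<Rightarrow> 'v::ab_group_add \<Rightarrow> 'v) \<Rightarrow> ('v \<Rightarrow> 'v \<Rightarrow> 'v) \<Rightarrow> ('v \<Rightarrow> 'v) \<Rightarrow> ('v \<Rightarrow> 'v)
    \<Rightarrow> (('v \<Rightarrow> 'v) \<times> ('v \<Rightarrow> 'v)) set" where
  "nijenhuis_conj scl br \<alpha> \<beta> =
    {(N, N'). N \<in> nijenhuis_operators scl br \<alpha> \<beta> \<and> N' \<in> nijenhuis_operators scl br \<alpha> \<beta> \<and>
        (\<exists>\<phi> \<in> bihom_automorphisms scl br \<alpha> \<beta>. N' = \<phi> \<circ> N \<circ> inv \<phi>)}"

definition nijenhuis_moduli ::
  "(complex \<Rightarrow> 'v::ab_group_add \<Rightarrow> 'v) \<Rightarrow> ('v \<Rightarrow> 'v \<Rightarrow> 'v) \<Rightarrow> ('v \<Rightarrow> 'v) \<Rightarrow> ('v \<Rightarrow> 'v)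
    \<Rightarrow> ('v \<Rightarrow> 'v) set set" where
  "nijenhuis_moduli scl br \<alpha> \<beta> =
    nijenhuis_operators scl br \<alpha> \<beta> // nijenhuis_conj scl br \<alpha> \<beta>"

definition quotient_space :: "'x topology \<Rightarrow> ('x \<times> 'x) set \<Rightarrow> 'x set topology" where
  "quotient_space X R =
    topology (\<lambda>U. U \<subseteq> topspace X // R \<and> openin X {x \<in> topspace X. R `` {x} \<in> U})"

lemma openin_quotient_space:
  "openin (quotient_space X R) U \<longleftrightarrow>
    U \<subseteq> topspace X // R \<and> openin X {x \<in> topspace X. R `` {x} \<in> U}"
proof -
  let ?P = "\<lambda>U. U \<subseteq> topspace X // R \<and> openin X {x \<in> topspace X. R `` {x} \<in> U}"
  have "?P (S \<inter> T)" if "?P S" "?P T" for S T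
  proof -
    have "{x \<in> topspace X. R `` {x} \<in> S \<inter> T} =
        {x \<in> topspace X. R `` {x} \<in> S} \<inter> {x \<in> topspace X. R `` {x} \<in> T}" by blast
    then show ?thesis using that by auto
  qed
  moreover have "?P (\<Union>K)" if "\<forall>U\<in>K. ?P U" for K
  proof -
    have "{x \<in> topspace X. R `` {x} \<in> \<Union>K} = (\<Union>U\<in>K. {x \<in> topspace X. R `` {x} \<in> U})" by blast
    moreover have "openin X (\<Union>U\<in>K. {x \<in> topspace X. R `` {x} \<in> U})" using that by blast
    ultimately show ?thesis using that by auto
  qed
  ultimately have "istopology ?P" unfolding istopology_def by blast
  then show ?thesis by (simp add: quotient_space_def)
qed

lemma topspace_quotient_space: "topspace (quotient_space X R) = topspace X // R"
proof -
  have "{x \<in> topspace X. R `` {x} \<in> topspace X // R} = topspace X"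
    by (auto simp: quotient_def)
  then have "openin (quotient_space X R) (topspace X // R)"
    by (simp add: openin_quotient_space)
  then show ?thesis
    by (metis openin_quotient_space openin_subset openin_topspace subset_antisym)
qed

lemma quotient_map_quotient_space: "quotient_map X (quotient_space X R) (\<lambda>x. R `` {x})"
  unfolding quotient_map_def
  by (auto simp: topspace_quotient_space openin_quotient_space quotient_def)

text \<open>
  On \<^typ>\<open>complex ^ 'n \<Rightarrow> complex ^ 'n\<close> the library topology is that of pointwise convergence;
  on the linear maps it induces the usual topology of a finite-dimensional space.
\<close>

definition moduli_topology ::
  "(complex ^ 'n \<Rightarrow> complex ^ 'n \<Rightarrow> complex ^ 'n) \<Rightarrow> (complex ^ 'n \<Rightarrow> complex ^ 'n)
    \<Rightarrow> (complex ^ 'n \<Rightarrow> complex ^ 'n) \<Rightarrow> (complex ^ 'n \<Rightarrow> complex ^ 'n) set topology" where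
  "moduli_topology br \<alpha> \<beta> =
    quotient_space (top_of_set (nijenhuis_operators (*s) br \<alpha> \<beta>)) (nijenhuis_conj (*s) br \<alpha> \<beta>)"

inductive_set polynomials_in :: "('x \<Rightarrow> complex) set \<Rightarrow> ('x \<Rightarrow> complex) set"
  for G :: "('x \<Rightarrow> complex) set" where
  const: "(\<lambda>_. c) \<in> polynomials_in G"
| coord: "g \<in> G \<Longrightarrow> g \<in> polynomials_in G"
| add: "p \<in> polynomials_in G \<Longrightarrow> q \<in> polynomials_in G \<Longrightarrow> (\<lambda>x. p x + q x) \<in> polynomials_in G"
| mult: "p \<in> polynomials_in G \<Longrightarrow> q \<in> polynomials_in G \<Longrightarrow> (\<lambda>x. p x * q x) \<in> polynomials_in G"

definition regular_on :: "'x set \<Rightarrow> ('x \<Rightarrow> complex) set \<Rightarrow> ('x \<Rightarrow> complex) \<Rightarrow> bool" where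
  "regular_on S G f \<longleftrightarrow> (\<exists>p \<in> polynomials_in G. \<forall>x\<in>S. f x = p x)"

definition vector_coords :: "(complex ^ 'n \<Rightarrow> complex) set" where
  "vector_coords = {\<lambda>v. v $ i | i. True}"

definition matrix_coords :: "((complex ^ 'n \<Rightarrow> complex ^ 'n) \<Rightarrow> complex) set" where
  "matrix_coords = {\<lambda>N. N (axis j 1) $ i | i j. True}"

text \<open>
  A function on the moduli space is regular if its pullback to the set of Nijenhuis operators is;
  the regular functions are thus the conjugation-invariant polynomial functions of the matrix
  entries.
\<close>

definition moduli_regular ::
  "(complex ^ 'n \<Rightarrow> complex ^ 'n \<Rightarrow> complex ^ 'n) \<Rightarrow> (complex ^ 'n \<Rightarrow> complex ^ 'n)
    \<Rightarrow> (complex ^ 'n \<Rightarrow> complex ^ 'n) \<Rightarrow> ((complex ^ 'n \<Rightarrow> complex ^ 'n) set \<Rightarrow> complex) \<Rightarrow> bool"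
  where
  "moduli_regular br \<alpha> \<beta> f \<longleftrightarrow>
    regular_on (nijenhuis_operators (*s) br \<alpha> \<beta>) matrix_coords
      (\<lambda>N. f (nijenhuis_conj (*s) br \<alpha> \<beta> `` {N}))"

text \<open>
  \<open>\<complex>\<^sup>2 \<union>\<^sub>\<complex> \<complex>\<^sup>2\<close> is modelled by the union of two coordinate planes in three-space, which meet in
  the third coordinate axis. Any two distinct planes in three-space that meet are carried to these
  by an affine change of coordinates.
\<close>

definition plane1 :: "(complex ^ 3) set" where "plane1 = {v. v $ 1 = 0}"

definition plane2 :: "(complex ^ 3) set" where "plane2 = {v. v $ 2 = 0}"

definition L1_alpha :: "complex \<Rightarrow> complex ^ 3 \<Rightarrow> complex ^ 3" where
  "L1_alpha a x = vector [x $ 1, a * x $ 2, (1 / a) * x $ 3]"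

definition L1_beta :: "complex \<Rightarrow> complex ^ 3 \<Rightarrow> complex ^ 3" where
  "L1_beta b x = vector [x $ 1, b * x $ 2, (1 / b) * x $ 3]"

text \<open>Bilinear extension of the multiplication table on the standard basis \<open>axis i 1\<close>.\<close>

definition L1_bracket :: "complex \<Rightarrow> complex \<Rightarrow> complex ^ 3 \<Rightarrow> complex ^ 3 \<Rightarrow> complex ^ 3" where
  "L1_bracket a b x y =
      (x $ 1 * y $ 2) *s ((2 * b) *s axis 2 1)
    + (x $ 1 * y $ 3) *s ((- (2 / b)) *s axis 3 1)
    + (x $ 2 * y $ 1) *s ((- (2 * a)) *s axis 2 1)
    + (x $ 2 * y $ 3) *s ((a / b) *s axis 1 1)
    + (x $ 3 * y $ 1) *s ((2 / a) *s axis 3 1)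
    + (x $ 3 * y $ 2) *s ((- (b / a)) *s axis 1 1)"

end

theory Submission
  imports Defs
begin

text \<open>
  Since \<open>a \<noteq> 0, 1, -1\<close>, the eigenvalues \<open>1, a, 1/a\<close> of \<open>\<alpha>\<close> are distinct, and every linear map that
  commutes with \<open>\<alpha>\<close> is diagonal (\<open>L1_commuting_diagonal\<close>). This applies both to Nijenhuis operators
  and to automorphisms. Diagonal maps commute with each other, so conjugation acts trivially and
  the moduli space is the set of Nijenhuis operators itself (\<open>L1_nijenhuis_conj\<close>).

  For a diagonal map \<open>diag(d\<^sub>1, d\<^sub>2, d\<^sub>3)\<close> the Nijenhuis identity reads
  \<open>d\<^sub>i d\<^sub>j = d\<^sub>k (d\<^sub>i + d\<^sub>j - d\<^sub>k)\<close>, that is \<open>(d\<^sub>k - d\<^sub>i) (d\<^sub>k - d\<^sub>j) = 0\<close>, whenever \<open>[e\<^sub>i, e\<^sub>j]\<close> is a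
  nonzero multiple of \<open>e\<^sub>k\<close>. It is automatic for \<open>k = i\<close> or \<open>k = j\<close>, so only \<open>[e\<^sub>2, e\<^sub>3]\<close>, a multiple of
  \<open>e\<^sub>1\<close>, gives a condition: \<open>(d\<^sub>1 - d\<^sub>2) (d\<^sub>1 - d\<^sub>3) = 0\<close> (\<open>diagonal_map_nijenhuis_iff\<close>). This is a union of
  two planes that meet in the line of scalar maps. The linear coordinates
  \<open>(d\<^sub>2 - d\<^sub>1, d\<^sub>3 - d\<^sub>1, d\<^sub>1)\<close> carry it to the two coordinate planes; they and their inverse are given by
  polynomials, hence respect both the topology and the regular functions.
\<close>

section \<open>Diagonal maps\<close>

definition diagonal_map :: "complex ^ 'n \<Rightarrow> complex ^ 'n \<Rightarrow> complex ^ 'n" where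
  "diagonal_map d x = (\<chi> i. d $ i * x $ i)"

lemma diagonal_map_nth [simp]: "diagonal_map d x $ i = d $ i * x $ i"
  by (simp add: diagonal_map_def)

lemma linear_diagonal_map: "Vector_Spaces.linear (*s) (*s) (diagonal_map d)"
  by (simp add: Vector_Spaces.linear_iff vec.vector_space_axioms vec_eq_iff algebra_simps)

lemma diagonal_map_commute: "diagonal_map d \<circ> diagonal_map d' = diagonal_map d' \<circ> diagonal_map d"
  by (simp add: fun_eq_iff vec_eq_iff)

text \<open>
  A map that commutes with \<open>diagonal_map d\<close> preserves its eigenspaces, and for distinct diagonal
  entries these are the coordinate lines.
\<close>

lemma linear_commuting_with_diagonal_map:
  fixes N :: "complex ^ 'n \<Rightarrow> complex ^ 'n"
  assumes lin: "Vector_Spaces.linear (*s) (*s) N"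
    and comm: "N \<circ> diagonal_map d = diagonal_map d \<circ> N"
    and distinct: "inj (\<lambda>i. d $ i)"
  shows "N = diagonal_map (\<chi> i. N (axis i 1) $ i)"
proof -
  have off_diagonal: "N (axis j 1) $ i = 0" if "i \<noteq> j" for i j
  proof -
    have "diagonal_map d (axis j 1) = d $ j *s axis j 1"
      by (simp add: vec_eq_iff axis_def)
    then have "d $ j *s N (axis j 1) = diagonal_map d (N (axis j 1))"
      using comm by (metis comp_apply lin vec.linear_scale)
    then have "d $ j * N (axis j 1) $ i = d $ i * N (axis j 1) $ i"
      by (metis diagonal_map_nth vector_smult_component)
    moreover have "d $ j \<noteq> d $ i"
      using distinct that by (metis injD)
    ultimately show ?thesis by simp
  qed
  have "N x $ i = N (axis i 1) $ i * x $ i" for x i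
  proof -
    have "N x $ i = (\<Sum>j\<in>UNIV. x $ j * N (axis j 1) $ i)"
      by (rule Cartesian_Space.linear_componentwise[OF lin])
    also have "\<dots> = (\<Sum>j\<in>UNIV. if j = i then x $ i * N (axis i 1) $ i else 0)"
      by (rule sum.cong) (auto simp: off_diagonal)
    finally show ?thesis by simp
  qed
  then show ?thesis
    unfolding fun_eq_iff vec_eq_iff diagonal_map_nth vec_lambda_beta by blast
qed

section \<open>Transport of regular functions\<close>

lemma polynomials_in_diff:
  assumes "p \<in> polynomials_in G" and "q \<in> polynomials_in G"
  shows "(\<lambda>x. p x - q x) \<in> polynomials_in G"
proof -
  have "(\<lambda>x. p x + (-1) * q x) \<in> polynomials_in G"
    using assms by (intro polynomials_in.add polynomials_in.mult polynomials_in.const)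
  then show ?thesis by simp
qed

lemma polynomials_in_compose:
  assumes "p \<in> polynomials_in H" and "\<And>h. h \<in> H \<Longrightarrow> (\<lambda>x. h (F x)) \<in> polynomials_in G"
  shows "(\<lambda>x. p (F x)) \<in> polynomials_in G"
  using assms(1)
  by induction (auto intro: assms(2) polynomials_in.intros)

text \<open>
  Applied to a bijection and to its inverse, both given by polynomials in the coordinates, this
  identifies the regular functions of two spaces.
\<close>

lemma regular_on_compose:
  assumes "regular_on T H f" and "F ` S \<subseteq> T"
    and "\<And>h. h \<in> H \<Longrightarrow> (\<lambda>x. h (F x)) \<in> polynomials_in G"
  shows "regular_on S G (\<lambda>x. f (F x))"
proof -
  obtain p where p: "p \<in> polynomials_in H" and eq: "\<forall>y\<in>T. f y = p y"
    using assms(1) by (auto simp: regular_on_def)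
  have "(\<lambda>x. p (F x)) \<in> polynomials_in G"
    using p assms(3) by (rule polynomials_in_compose)
  moreover have "\<forall>x\<in>S. f (F x) = p (F x)"
    using eq assms(2) by auto
  ultimately show ?thesis
    unfolding regular_on_def by (intro bexI[where x = "\<lambda>x. p (F x)"])
qed

section \<open>The algebra\<close>

lemma L1_bracket_nth [simp]:
  "L1_bracket a b x y $ 1 = (a / b) * (x $ 2 * y $ 3) - (b / a) * (x $ 3 * y $ 2)"
  "L1_bracket a b x y $ 2 = 2 * b * (x $ 1 * y $ 2) - 2 * a * (x $ 2 * y $ 1)"
  "L1_bracket a b x y $ 3 = (2 / a) * (x $ 3 * y $ 1) - (2 / b) * (x $ 1 * y $ 3)"
  by (simp_all add: L1_bracket_def axis_def algebra_simps)

lemma L1_alpha_diagonal: "L1_alpha a = diagonal_map (vector [1, a, 1 / a])"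
  by (simp add: L1_alpha_def fun_eq_iff vec_eq_iff forall_3)

lemma L1_beta_diagonal: "L1_beta b = diagonal_map (vector [1, b, 1 / b])"
  by (simp add: L1_beta_def fun_eq_iff vec_eq_iff forall_3)

text \<open>
  At \<open>a = b = 1\<close> the structure maps are the identity and the bracket is that of \<open>sl\<^sub>2\<close> with
  \<open>e\<^sub>1\<close> as Cartan element. The general bracket is its Yau twist, so that the axioms of a BiHom-Lie
  algebra reduce to those of \<open>sl\<^sub>2\<close>.
\<close>

lemma L1_bracket_twist:
  assumes "a \<noteq> 0" and "b \<noteq> 0"
  shows "L1_bracket a b x y = L1_bracket 1 1 (L1_alpha a x) (L1_beta b y)"
  using assms by (simp add: L1_alpha_diagonal L1_beta_diagonal vec_eq_iff forall_3 algebra_simps)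

lemma sl2_skew: "L1_bracket 1 1 x y = - L1_bracket 1 1 y x"
  by (simp add: vec_eq_iff forall_3)

lemma sl2_jacobi:
  "L1_bracket 1 1 x (L1_bracket 1 1 y z) + L1_bracket 1 1 y (L1_bracket 1 1 z x)
    + L1_bracket 1 1 z (L1_bracket 1 1 x y) = 0"
  by (simp add: vec_eq_iff forall_3 algebra_simps)

lemma sl2_automorphisms:
  "c \<noteq> 0 \<Longrightarrow> L1_alpha c (L1_bracket 1 1 x y) = L1_bracket 1 1 (L1_alpha c x) (L1_alpha c y)"
  "c \<noteq> 0 \<Longrightarrow> L1_beta c (L1_bracket 1 1 x y) = L1_bracket 1 1 (L1_beta c x) (L1_beta c y)"
  by (simp_all add: L1_alpha_diagonal L1_beta_diagonal vec_eq_iff forall_3 algebra_simps)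

lemma L1_bihom_lie_algebra:
  assumes "a \<noteq> 0" and "b \<noteq> 0"
  shows "bihom_lie_algebra (*s) (L1_bracket a b) (L1_alpha a) (L1_beta b)"
proof -
  note twist = L1_bracket_twist[OF assms]
  note aut = sl2_automorphisms(1)[OF assms(1)] sl2_automorphisms(2)[OF assms(2)]
  have comm: "L1_alpha a \<circ> L1_beta b = L1_beta b \<circ> L1_alpha a"
    unfolding L1_alpha_diagonal L1_beta_diagonal by (rule diagonal_map_commute)
  then have swap: "L1_alpha a (L1_beta b x) = L1_beta b (L1_alpha a x)" for x
    by (simp add: fun_eq_iff)
  show ?thesis
  proof (intro bihom_lie_algebra.intro bihom_lie_algebra_axioms.intro)
    show "vector_space ((*s) :: complex \<Rightarrow> complex ^ 3 \<Rightarrow> _)"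
      by (rule vec.vector_space_axioms)
    show "Vector_Spaces.linear (*s) (*s) (\<lambda>y. L1_bracket a b x y)" for x
      by (simp add: Vector_Spaces.linear_iff vec.vector_space_axioms vec_eq_iff forall_3 algebra_simps)
    show "Vector_Spaces.linear (*s) (*s) (\<lambda>x. L1_bracket a b x y)" for y
      by (simp add: Vector_Spaces.linear_iff vec.vector_space_axioms vec_eq_iff forall_3 algebra_simps)
    show "Vector_Spaces.linear (*s) (*s) (L1_alpha a)"
      unfolding L1_alpha_diagonal by (rule linear_diagonal_map)
    show "Vector_Spaces.linear (*s) (*s) (L1_beta b)"
      unfolding L1_beta_diagonal by (rule linear_diagonal_map)
    show "L1_alpha a \<circ> L1_beta b = L1_beta b \<circ> L1_alpha a"
      by (rule comm)
    show "L1_alpha a (L1_bracket a b x y) = L1_bracket a b (L1_alpha a x) (L1_alpha a y)" for x y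
      by (simp only: twist aut swap)
    show "L1_beta b (L1_bracket a b x y) = L1_bracket a b (L1_beta b x) (L1_beta b y)" for x y
      by (simp only: twist aut swap)
    show "L1_bracket a b (L1_beta b x) (L1_alpha a y) = - L1_bracket a b (L1_beta b y) (L1_alpha a x)"
      for x y
      unfolding twist swap by (rule sl2_skew)
    show "L1_bracket a b (L1_beta b (L1_beta b x)) (L1_bracket a b (L1_beta b y) (L1_alpha a z))
      + L1_bracket a b (L1_beta b (L1_beta b y)) (L1_bracket a b (L1_beta b z) (L1_alpha a x))
      + L1_bracket a b (L1_beta b (L1_beta b z)) (L1_bracket a b (L1_beta b x) (L1_alpha a y)) = 0"
      for x y z
      \<comment> \<open>Every summand becomes a nested \<open>sl\<^sub>2\<close> bracket of \<open>\<alpha>\<beta>\<^sup>2 x\<close>, \<open>\<alpha>\<beta>\<^sup>2 y\<close> and \<open>\<alpha>\<beta>\<^sup>2 z\<close>.\<close>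
      unfolding twist aut swap by (rule sl2_jacobi)
  qed
qed

section \<open>Nijenhuis operators and automorphisms\<close>

lemma L1_commuting_diagonal:
  assumes "a \<noteq> 0" and "a \<noteq> 1" and "a \<noteq> - 1"
    and "Vector_Spaces.linear (*s) (*s) N" and "N \<circ> L1_alpha a = L1_alpha a \<circ> N"
  shows "N = diagonal_map (\<chi> i. N (axis i 1) $ i)"
proof (rule linear_commuting_with_diagonal_map[OF assms(4)])
  show "N \<circ> diagonal_map (vector [1, a, 1 / a]) = diagonal_map (vector [1, a, 1 / a]) \<circ> N"
    using assms(5) by (simp add: L1_alpha_diagonal)
  have "a * a \<noteq> 1"
    using assms(2,3) by (metis square_eq_1_iff)
  then show "inj (\<lambda>i. (vector [1, a, 1 / a] :: complex ^ 3) $ i)"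
    using assms(1-3) by (simp add: inj_def forall_3 field_simps)
qed

text \<open>
  The two sides of the Nijenhuis identity differ by \<open>(d\<^sub>1 - d\<^sub>2) (d\<^sub>1 - d\<^sub>3)\<close> times the first
  coordinate of the bracket.
\<close>

lemma diagonal_map_nijenhuis_iff:
  assumes "a \<noteq> 0" and "b \<noteq> 0"
  shows "diagonal_map d \<in> nijenhuis_operators (*s) (L1_bracket a b) (L1_alpha a) (L1_beta b)
    \<longleftrightarrow> (d $ 1 - d $ 2) * (d $ 1 - d $ 3) = 0" (is "?N \<in> _ \<longleftrightarrow> ?c = 0")
proof -
  let ?br = "L1_bracket a b"
  have torsion: "?br (?N x) (?N y) = ?N (?br (?N x) y + ?br x (?N y) - ?N (?br x y))
      \<longleftrightarrow> ?c * ?br x y $ 1 = 0" for x y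
  proof -
    have "?br (?N x) (?N y) $ 1 - ?N (?br (?N x) y + ?br x (?N y) - ?N (?br x y)) $ 1
        = ?c * ?br x y $ 1"
      by (simp add: algebra_simps)
    moreover have "?br (?N x) (?N y) $ i = ?N (?br (?N x) y + ?br x (?N y) - ?N (?br x y)) $ i"
      if "i = 2 \<or> i = 3" for i
      using that by (auto simp: algebra_simps)
    ultimately show ?thesis
      unfolding vec_eq_iff forall_3 by (metis eq_iff_diff_eq_0)
  qed
  have "?br (axis 2 1) (axis 3 1) $ 1 \<noteq> 0"
    using assms by (simp add: axis_def)
  then have "(\<forall>x y. ?c * ?br x y $ 1 = 0) \<longleftrightarrow> ?c = 0"
    by (metis mult_eq_0_iff)
  then show ?thesis
    by (simp only: nijenhuis_operators_def mem_Collect_eq torsion L1_alpha_diagonal L1_beta_diagonal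
      linear_diagonal_map diagonal_map_commute[of d] simp_thms)
qed

text \<open>Automorphisms and Nijenhuis operators are all diagonal, and therefore commute.\<close>

lemma L1_nijenhuis_conj:
  assumes "a \<noteq> 0" and "a \<noteq> 1" and "a \<noteq> - 1"
  shows "nijenhuis_conj (*s) (L1_bracket a b) (L1_alpha a) (L1_beta b)
    = Id_on (nijenhuis_operators (*s) (L1_bracket a b) (L1_alpha a) (L1_beta b))"
    (is "?R = Id_on ?Nij")
proof -
  have "\<phi> \<circ> N \<circ> inv \<phi> = N"
    if "N \<in> ?Nij" and "\<phi> \<in> bihom_automorphisms (*s) (L1_bracket a b) (L1_alpha a) (L1_beta b)"
    for N \<phi>
  proof -
    have bij: "bij \<phi>"
      using that(2) by (simp add: bihom_automorphisms_def)
    define d where "d = (\<chi> i. N (axis i 1) $ i)"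
    define d' where "d' = (\<chi> i. \<phi> (axis i 1) $ i)"
    have d: "N = diagonal_map d"
      unfolding d_def by (rule L1_commuting_diagonal[OF assms])
        (use that(1) in \<open>simp_all add: nijenhuis_operators_def\<close>)
    have d': "\<phi> = diagonal_map d'"
      unfolding d'_def by (rule L1_commuting_diagonal[OF assms])
        (use that(2) in \<open>simp_all add: bihom_automorphisms_def\<close>)
    have "\<phi> \<circ> N \<circ> inv \<phi> = N \<circ> (\<phi> \<circ> inv \<phi>)"
      unfolding d d' using diagonal_map_commute[of d' d] by (simp only: o_assoc)
    also have "\<dots> = N"
      using bij bij_is_surj surj_iff by (metis comp_id)
    finally show ?thesis .
  qed
  moreover have "id \<in> bihom_automorphisms (*s) (L1_bracket a b) (L1_alpha a) (L1_beta b)"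
    by (simp add: bihom_automorphisms_def vec.linear_id)
  ultimately have "(\<exists>\<phi> \<in> bihom_automorphisms (*s) (L1_bracket a b) (L1_alpha a) (L1_beta b).
      N' = \<phi> \<circ> N \<circ> inv \<phi>) \<longleftrightarrow> N' = N" if "N \<in> ?Nij" for N N'
    using that by (metis comp_id id_comp inv_id)
  then show ?thesis
    unfolding nijenhuis_conj_def by (auto simp: Id_on_def)
qed

section \<open>Parametrization by the two planes\<close>

text \<open>
  The first two parameters are the differences of eigenvalues one of which has to vanish; the third
  is the eigenvalue on \<open>e\<^sub>1\<close>, which is free and parametrizes the scalar maps on the common line.
\<close>

definition plane_operator :: "complex ^ 3 \<Rightarrow> complex ^ 3 \<Rightarrow> complex ^ 3" where
  "plane_operator v = diagonal_map (vector [v $ 3, v $ 3 + v $ 1, v $ 3 + v $ 2])"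

definition plane_coords :: "(complex ^ 3 \<Rightarrow> complex ^ 3) \<Rightarrow> complex ^ 3" where
  "plane_coords N = (\<chi> i. if i = 3 then N (axis 1 1) $ 1
     else if i = 1 then N (axis 2 1) $ 2 - N (axis 1 1) $ 1
     else N (axis 3 1) $ 3 - N (axis 1 1) $ 1)"

lemma plane_coords_nth [simp]:
  "plane_coords N $ 1 = N (axis 2 1) $ 2 - N (axis 1 1) $ 1"
  "plane_coords N $ 2 = N (axis 3 1) $ 3 - N (axis 1 1) $ 1"
  "plane_coords N $ 3 = N (axis 1 1) $ 1"
  by (simp_all add: plane_coords_def)

lemma plane_coords_plane_operator: "plane_coords (plane_operator v) = v"
  by (simp add: vec_eq_iff forall_3 plane_operator_def axis_def)

lemma plane_operator_plane_coords:
  fixes N :: "complex ^ 3 \<Rightarrow> complex ^ 3"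
  assumes "N = diagonal_map (\<chi> i. N (axis i 1) $ i)"
  shows "plane_operator (plane_coords N) = N"
  by (subst (2) assms) (simp add: plane_operator_def fun_eq_iff vec_eq_iff forall_3)

lemma homeomorphic_maps_planes_nijenhuis:
  assumes "a \<noteq> 0" and "b \<noteq> 0" and "a \<noteq> 1" and "a \<noteq> - 1"
  shows "homeomorphic_maps (top_of_set (plane1 \<union> plane2))
    (top_of_set (nijenhuis_operators (*s) (L1_bracket a b) (L1_alpha a) (L1_beta b)))
    plane_operator plane_coords" (is "homeomorphic_maps (top_of_set ?P) (top_of_set ?Nij) _ _")
proof -
  have op: "plane_operator v \<in> ?Nij" if "v \<in> ?P" for v
    using that diagonal_map_nijenhuis_iff[OF assms(1,2)]
    by (auto simp: plane_operator_def plane1_def plane2_def)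
  have inverse: "plane_operator (plane_coords N) = N" if "N \<in> ?Nij" for N
    by (rule plane_operator_plane_coords, rule L1_commuting_diagonal[OF assms(1,3,4)])
      (use that in \<open>simp_all add: nijenhuis_operators_def\<close>)
  have coords: "plane_coords N \<in> ?P" if "N \<in> ?Nij" for N
  proof -
    have "plane_operator (plane_coords N) \<in> ?Nij"
      using that inverse by simp
    then show ?thesis
      unfolding plane_operator_def diagonal_map_nijenhuis_iff[OF assms(1,2)]
      by (auto simp: plane1_def plane2_def)
  qed
  have "continuous_on ?P plane_operator"
  proof (rule continuous_on_coordinatewise_then_product)
    fix x :: "complex ^ 3"
    have "(\<lambda>v. plane_operator v x) = (\<lambda>v. \<chi> i. (if i = 1 then v $ 3 else
        if i = 2 then v $ 3 + v $ 1 else v $ 3 + v $ 2) * x $ i)"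
      by (simp add: plane_operator_def fun_eq_iff vec_eq_iff forall_3)
    moreover have "continuous_on ?P \<dots>"
    proof (rule continuous_on_vec_lambda)
      show "continuous_on ?P (\<lambda>v. (if i = 1 then v $ 3 else
          if i = 2 then v $ 3 + v $ 1 else v $ 3 + v $ 2) * x $ i)" for i
        by (cases "i = 1"; cases "i = 2") (auto intro!: continuous_intros)
    qed
    ultimately show "continuous_on ?P (\<lambda>v. plane_operator v x)" by metis
  qed
  moreover have "continuous_on ?Nij plane_coords"
  proof -
    have entry: "continuous_on ?Nij (\<lambda>N. N (axis k 1) $ k)" for k
      by (intro continuous_on_component continuous_on_subset[OF continuous_on_product_coordinates]) auto
    show ?thesis
      unfolding plane_coords_def
    proof (rule continuous_on_vec_lambda)
      show "continuous_on ?Nij (\<lambda>N. if i = 3 then N (axis 1 1) $ 1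
          else if i = 1 then N (axis 2 1) $ 2 - N (axis 1 1) $ 1
          else N (axis 3 1) $ 3 - N (axis 1 1) $ 1)" for i :: 3
        by (cases "i = 3"; cases "i = 1") (simp_all add: continuous_on_diff entry)
    qed
  qed
  ultimately show ?thesis
    using op coords inverse plane_coords_plane_operator
    by (auto simp: homeomorphic_maps_def)
qed

text \<open>
  Matrix entries are polynomials in the plane parameters, and conversely: the parametrization is an
  isomorphism of algebraic sets.
\<close>

lemma matrix_coords_plane_operator:
  assumes "h \<in> matrix_coords"
  shows "(\<lambda>v. h (plane_operator v)) \<in> polynomials_in vector_coords"
proof -
  obtain i j where h: "h = (\<lambda>N. N (axis j 1) $ i)"
    using assms by (auto simp: matrix_coords_def)
  have coord: "(\<lambda>v. v $ k) \<in> polynomials_in vector_coords" for k :: 3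
    by (rule polynomials_in.coord) (auto simp: vector_coords_def)
  have "(\<lambda>v :: complex ^ 3. (vector [v $ 3, v $ 3 + v $ 1, v $ 3 + v $ 2] :: complex ^ 3) $ i)
      \<in> polynomials_in vector_coords"
    using exhaust_3[of i] by (elim disjE) (simp_all add: polynomials_in.add coord)
  then show ?thesis
    unfolding h plane_operator_def diagonal_map_nth
    by (intro polynomials_in.mult polynomials_in.const)
qed

lemma vector_coords_plane_coords:
  assumes "h \<in> vector_coords"
  shows "(\<lambda>N. h (plane_coords N)) \<in> polynomials_in matrix_coords"
proof -
  obtain i where h: "h = (\<lambda>v. v $ i)"
    using assms by (auto simp: vector_coords_def)
  have entry: "(\<lambda>N. N (axis k 1) $ k) \<in> polynomials_in matrix_coords" for k :: 3
    by (rule polynomials_in.coord) (auto simp: matrix_coords_def)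
  show ?thesis
    unfolding h using exhaust_3[of i] by (elim disjE) (simp_all add: polynomials_in_diff entry)
qed

theorem theorem11p1:
  fixes a b :: complex
  assumes "a \<noteq> 0" and "b \<noteq> 0"
    and "a \<noteq> 1" and "a \<noteq> - 1" and "b \<noteq> 1" and "b \<noteq> - 1"
    and "a \<noteq> b" and "a \<noteq> inverse b"
  shows "bihom_lie_algebra (*s) (L1_bracket a b) (L1_alpha a) (L1_beta b) \<and>
    (\<exists>\<Phi>. bij_betw \<Phi> (plane1 \<union> plane2)
            (nijenhuis_moduli (*s) (L1_bracket a b) (L1_alpha a) (L1_beta b)) \<and>
         homeomorphic_map (top_of_set (plane1 \<union> plane2))
            (moduli_topology (L1_bracket a b) (L1_alpha a) (L1_beta b)) \<Phi> \<and>
         (\<forall>f. moduli_regular (L1_bracket a b) (L1_alpha a) (L1_beta b) f \<longleftrightarrow>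
              regular_on (plane1 \<union> plane2) vector_coords (\<lambda>v. f (\<Phi> v))))"
proof -
  let ?P = "plane1 \<union> plane2"
  let ?Nij = "nijenhuis_operators (*s) (L1_bracket a b) (L1_alpha a) (L1_beta b)"
  let ?R = "nijenhuis_conj (*s) (L1_bracket a b) (L1_alpha a) (L1_beta b)"
  let ?M = "moduli_topology (L1_bracket a b) (L1_alpha a) (L1_beta b)"
  define \<Phi> where "\<Phi> = (\<lambda>N. ?R `` {N}) \<circ> plane_operator"
  have maps: "homeomorphic_maps (top_of_set ?P) (top_of_set ?Nij) plane_operator plane_coords"
    using assms by (intro homeomorphic_maps_planes_nijenhuis)
  have op: "plane_operator ` ?P \<subseteq> ?Nij" and coords: "plane_coords ` ?Nij \<subseteq> ?P"
    and inverse: "\<And>N. N \<in> ?Nij \<Longrightarrow> plane_operator (plane_coords N) = N"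
    using maps by (auto simp: homeomorphic_maps_def continuous_map_def)
  have R: "?R = Id_on ?Nij"
    using assms by (intro L1_nijenhuis_conj)
  \<comment> \<open>The classes are singletons, so the quotient map is injective and thus a homeomorphism.\<close>
  have "quotient_map (top_of_set ?Nij) ?M (\<lambda>N. ?R `` {N})"
    unfolding moduli_topology_def by (rule quotient_map_quotient_space)
  moreover have "inj_on (\<lambda>N. ?R `` {N}) ?Nij"
    by (auto simp: R inj_on_def)
  ultimately have "homeomorphic_map (top_of_set ?Nij) ?M (\<lambda>N. ?R `` {N})"
    by (simp add: homeomorphic_map_def)
  then have homeo: "homeomorphic_map (top_of_set ?P) ?M \<Phi>"
    unfolding \<Phi>_def using maps homeomorphic_map_compose homeomorphic_maps_map by blast
  moreover have "topspace ?M = nijenhuis_moduli (*s) (L1_bracket a b) (L1_alpha a) (L1_beta b)"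
    by (simp add: moduli_topology_def topspace_quotient_space nijenhuis_moduli_def)
  ultimately have bij: "bij_betw \<Phi> ?P (nijenhuis_moduli (*s) (L1_bracket a b) (L1_alpha a) (L1_beta b))"
    by (metis bij_betw_def homeomorphic_imp_injective_map homeomorphic_imp_surjective_map
        topspace_euclidean_subtopology)
  have regular: "moduli_regular (L1_bracket a b) (L1_alpha a) (L1_beta b) f
      \<longleftrightarrow> regular_on ?P vector_coords (\<lambda>v. f (\<Phi> v))" for f
  proof
    assume "moduli_regular (L1_bracket a b) (L1_alpha a) (L1_beta b) f"
    then show "regular_on ?P vector_coords (\<lambda>v. f (\<Phi> v))"
      unfolding moduli_regular_def \<Phi>_def comp_def
      by (rule regular_on_compose) (use op matrix_coords_plane_operator in auto)
  next
    assume "regular_on ?P vector_coords (\<lambda>v. f (\<Phi> v))"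
    then have "regular_on ?Nij matrix_coords (\<lambda>N. f (\<Phi> (plane_coords N)))"
      by (rule regular_on_compose) (use coords vector_coords_plane_coords in auto)
    then show "moduli_regular (L1_bracket a b) (L1_alpha a) (L1_beta b) f"
      unfolding moduli_regular_def regular_on_def \<Phi>_def by (simp add: inverse)
  qed
  show ?thesis
    using L1_bihom_lie_algebra[OF assms(1,2)] bij homeo regular by blast
qed

end
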